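(* With the Hoare sextuple $\Gamma;R;B\vdash\{P\}\,s\,\{Q\}$ defined semantically as in the context: for every closed assertion $\Gamma$, every $R:\mathsf{list}\,\mathsf{val}\to\mathsf{assert}$, every $B:\mathbb{N}\to\mathsf{assert}$, every assertion $I$ and every statement $s$, if $$\Gamma;R;B\vdash\{I\}\,s\,\{I\},$$ then $$\Gamma;R;B\vdash\{I\}\,\mathsf{loop}\,s\,\{\mathbf{false}\}.$$
   Context: **Syntax of Cminor.** Fix sets of identifiers, memory blocks $b$, chunk descriptors $ch$ and operation symbols $op$. Values are $v ::= \mathsf{Vundef}\mid \mathsf{Vint}(i)\mid \mathsf{Vptr}(b,i)\mid \mathsf{Vfloat}(f)$ with $i\in[0,2^{32})$ and $f$ a float. Expressions are $e ::= \mathsf{Eval}(v)\mid \mathsf{Evar}(x)\mid \mathsf{Eop}(op,el)\mid \mathsf{Eload}(ch,e)$, with $el$ a finite list of expressions. Statements are $s ::= x:=e \mid [e_1]_{ch}:=e_2 \mid \mathsf{loop}\,s \mid \mathsf{block}\,s \mid \mathsf{exit}\,n \mid \mathsf{call}\,xl\,e\,el \mid \mathsf{return}\,el \mid s_1;s_2 \mid \mathsf{if}\,e\,\mathsf{then}\,s_1\,\mathsf{else}\,s_2 \mid \mathsf{skip}$ ($n\in\mathbb{N}$, $xl$ a list of identifiers). A function $f=(xl,yl,n,s)$ has parameters $xl$, locals $yl$, stack-space size $n$ and body $\mathrm{body}(f)=s$. A program $\Psi$ consists of a partial map from identifiers to blocks and a partial map from blocks to functions. When a list of values $vl$ is used as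 a list of expressions it stands for the list of the $\mathsf{Eval}(v)$. **States.** A state is $\sigma=(sp;\rho;\phi;m)$: a stack-pointer block, a local environment (finite map from identifiers to values), a footprint, and a memory (a finite map from blocks to block contents, i.e. bounds plus a map from byte offsets to memory cells). Components are written $sp_\sigma,\rho_\sigma,\phi_\sigma,m_\sigma$; $\sigma[:=c]$ is $\sigma$ with the corresponding component replaced by $c$. Footprints assign permissions to addresses; they carry predicates $\phi\vdash\mathsf{load}_{ch}\,v$ and $\phi\vdash\mathsf{store}_{ch}\,v$ (all addresses from $v$ to $v+|ch|-1$ are readable, resp. writable) and a partial, commutative, associative operation $\oplus$ with unit $\emptyset$ (the empty footprint, with no permissions) such that, if $\phi_0\oplus\phi_1=\phi$: $\phi_0\vdash\mathsf{store}_{ch}v$ implies $\phi_1\not\vdash\mathsf{load}_{ch}v$; and $\phi_0\vdash\mathsf{load}_{ch}v$ (resp. $\mathsf{store}$) implies $\phi\vdash\mathsf{load}_{ch}v$ (resp. $\mathsf{store}$). Loading a chunk at an address of $m$, storing a chunk, and operator evaluation (depending on $\Psi$, $sp$, $op$ and the argument values only) are fixed partial functions. **Expression evaluation** $\Psi;\sigma\vdash e\Downarrow v$ is the least relation with: $\mathsf{Eval}(v)\Downarrow v$; $\mathsf{Evar}(x)\Downarrow\rho_\sigma(x)$ if $x\in\mathrm{dom}\,\rho_\sigma$; $\mathsf{Eop}(op,el)\Downarrow v$ if $el$ evaluates componentwise to $vl$ and operator evaluation of $op$ on $vl$ (with $\Psi$, $sp_\sigma$) gives $v$; $\mathsf{Eload}(ch,e_1)\Downarrow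 v$ if $e_1\Downarrow v_1$, $\phi_\sigma\vdash\mathsf{load}_{ch}v_1$, and loading chunk $ch$ at $v_1$ from $m_\sigma$ gives $v$. $\mathsf{is\_true}\,v$ holds iff $v$ is a pointer or nonzero integer; $\mathsf{is\_false}\,v$ iff $v$ is the integer $0$. **Controls and small steps.** Controls are $\kappa ::= \mathsf{Kstop}\mid s\cdot\kappa\mid\mathsf{Kblock}\,\kappa\mid\mathsf{Kcall}\,xl\,f\,sp\,\rho\,\kappa$. A continuation is a pair $(\sigma,\kappa)$. The relation $\Psi\vdash k\longmapsto k'$ is given exactly by: - $(\sigma,(s_1;s_2)\cdot\kappa)\longmapsto(\sigma,s_1\cdot s_2\cdot\kappa)$; - $(\sigma,(x:=e)\cdot\kappa)\longmapsto(\sigma[:=\rho_\sigma[x:=v]],\kappa)$ if $\Psi;\sigma\vdash e\Downarrow v$; - $(\sigma,([e_1]_{ch}:=e_2)\cdot\kappa)\longmapsto(\sigma[:=m'],\kappa)$ if $e_1\Downarrow v_1$, $e_2\Downarrow v_2$, $\phi_\sigma\vdash\mathsf{store}_{ch}v_1$ and $m'$ is the result of storing $v_2$ with chunk $ch$ at $v_1$ in $m_\sigma$; - $(\sigma,(\mathsf{if}\,e\,\mathsf{then}\,s_1\,\mathsf{else}\,s_2)\cdot\kappa)\longmapsto(\sigma,s_1\cdot\kappa)$ if $e\Downarrow v$ and $\mathsf{is\_true}\,v$, and $\longmapsto(\sigma,s_2\cdot\kappa)$ if $e\Downarrow v$ and $\mathsf{is\_false}\,v$; - $(\sigma,\mathsf{skip}\cdot\kappa)\longmapsto(\sigma,\kappa)$;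 - $(\sigma,(\mathsf{loop}\,s)\cdot\kappa)\longmapsto(\sigma,s\cdot(\mathsf{loop}\,s)\cdot\kappa)$; - $(\sigma,(\mathsf{block}\,s)\cdot\kappa)\longmapsto(\sigma,s\cdot\mathsf{Kblock}\,\kappa)$; - $(\sigma,\mathsf{exit}\,0\cdot s_1\cdots s_j\cdot\mathsf{Kblock}\,\kappa)\longmapsto(\sigma,\kappa)$ and $(\sigma,\mathsf{exit}\,(n+1)\cdot s_1\cdots s_j\cdot\mathsf{Kblock}\,\kappa)\longmapsto(\sigma,\mathsf{exit}\,n\cdot\kappa)$, for $j\ge 0$; - call: $(\sigma,(\mathsf{call}\,xl\,e\,el)\cdot\kappa)\longmapsto(\sigma',\mathrm{body}(f)\cdot\mathsf{Kcall}\,xl\,f\,sp_\sigma\,\rho_\sigma\,\kappa)$, where $(f,\sigma')$ (the called function and its entry state) is given by a fixed partial function of $(\Psi,\sigma,e,el)$, not depending on $\kappa$; - return: $(\sigma,(\mathsf{return}\,el)\cdot\kappa)\longmapsto(\sigma',\kappa')$ when removing the leading $s\cdot$ and $\mathsf{Kblock}$ operators of $\kappa$ leads to $\mathsf{Kcall}\,xl\,f\,sp\,\rho\,\kappa'$, where $\sigma'$ is given by a fixed partial function of $(\Psi,\sigma,xl,f,sp,\rho)$ and the values of $el$ in $\sigma$ (no step if some element of $el$ has no value). $(\sigma,\kappa)$ is stuck if $\kappa\ne\mathsf{Kstop}$ and it has no successor. $\Psi\vdash\mathsf{safe}(k)$ means no stuck continuation is reachable from $k$ by $\longmapsto^*$.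 **Assertions.** $\sigma\cong\sigma'$ means same stack pointer, (extensionally) equal environments, identical footprints, and memories agreeing on the footprint-visible portion. An assertion is a predicate $P\,\Psi\,\sigma$ on programs and states that is invariant under $\cong$. $\mathbf{false}$ is the assertion that never holds; $P\Rightarrow Q$ as a statement means $\forall\Psi\,\sigma.\,P\Psi\sigma\Rightarrow Q\Psi\sigma$. $(P*Q)\Psi\sigma$ holds iff there are $\phi_1,\phi_2$ with $\phi_\sigma=\phi_1\oplus\phi_2$, $P\Psi(\sigma[:=\phi_1])$ and $Q\Psi(\sigma[:=\phi_2])$. A closed assertion does not depend on the local environment $\rho$. **Guards.** $\mathbf{safe}\,\kappa$ is the assertion $\lambda\Psi\sigma.\,\forall\sigma'.\,(\sigma\cong\sigma'\Rightarrow\Psi\vdash\mathsf{safe}(\sigma',\kappa))$. For assertions $F,P$: $\mathrm{Guard}_F(P,\kappa)$ means $F*P\Rightarrow\mathbf{safe}\,\kappa$. $\mathrm{RGuard}_F(R,\kappa)$ means $\forall vl.\,\mathrm{Guard}_F(R(vl),(\mathsf{return}\,vl)\cdot\kappa)$. $\mathrm{BGuard}_F(B,\kappa)$ means $\forall n.\,\mathrm{Guard}_F(B(n),(\mathsf{exit}\,n)\cdot\kappa)$. **Frames and sextuples.** $\mathrm{mod}(s)$ is the syntactic set of variables modified by $s$: $\{x\}$ for $x:=e$, the elements of $xl$ for $\mathsf{call}\,xl\,e\,el$, the union over immediate substatements for compound statements, and empty otherwise. $\mathsf{closemod}(s,A)$ is $A$ closed over the variables in $\mathrm{mod}(s)$: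 it holds at $\Psi,\sigma$ iff $A\Psi(\sigma[:=\rho'])$ for all $\rho'$ agreeing with $\rho_\sigma$ outside $\mathrm{mod}(s)$. $\mathsf{frame}(\Gamma,A,s)=\Gamma*\mathsf{closemod}(s,A)$. The global context $\Gamma$ is a closed assertion. The Hoare sextuple $\Gamma;R;B\vdash\{P\}\,s\,\{Q\}$ is defined to mean: for all assertions $A$ and controls $\kappa$, writing $F=\mathsf{frame}(\Gamma,A,s)$, if $\mathrm{RGuard}_F(R,\kappa)$, $\mathrm{BGuard}_F(B,\kappa)$ and $\mathrm{Guard}_F(Q,\kappa)$, then $\mathrm{Guard}_F(P,s\cdot\kappa)$. *)

theory Defs
  imports Main "HOL-Library.Word" "HOL-Library.Finite_Map"
begin

text \<open>
  Type variables: \<open>'x\<close> identifiers, \<open>'b\<close> memory blocks, \<open>'fl\<close> floats, \<open>'c\<close> chunk descriptors,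
  \<open>'o\<close> operation symbols, \<open>'k\<close> memory cells, \<open>'p\<close> footprints.
\<close>

datatype ('b, 'fl) val =
    Vundef
  | Vint "32 word"
  | Vptr 'b "32 word"
  | Vfloat 'fl

datatype ('x, 'b, 'fl, 'c, 'o) expr =
    Eval "('b, 'fl) val"
  | Evar 'x
  | Eop 'o "('x, 'b, 'fl, 'c, 'o) expr list"
  | Eload 'c "('x, 'b, 'fl, 'c, 'o) expr"

datatype ('x, 'b, 'fl, 'c, 'o) stmt =
    Sassign 'x "('x, 'b, 'fl, 'c, 'o) expr"
  | Sstore 'c "('x, 'b, 'fl, 'c, 'o) expr" "('x, 'b, 'fl, 'c, 'o) expr"
  | Sloop "('x, 'b, 'fl, 'c, 'o) stmt"
  | Sblock "('x, 'b, 'fl, 'c, 'o) stmt"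
  | Sexit nat
  | Scall "'x list" "('x, 'b, 'fl, 'c, 'o) expr" "('x, 'b, 'fl, 'c, 'o) expr list"
  | Sreturn "('x, 'b, 'fl, 'c, 'o) expr list"
  | Sseq "('x, 'b, 'fl, 'c, 'o) stmt" "('x, 'b, 'fl, 'c, 'o) stmt"
  | Sif "('x, 'b, 'fl, 'c, 'o) expr" "('x, 'b, 'fl, 'c, 'o) stmt" "('x, 'b, 'fl, 'c, 'o) stmt"
  | Sskip

record ('x, 'b, 'fl, 'c, 'o) func =
  fn_params :: "'x list"
  fn_locals :: "'x list"
  fn_stackspace :: nat
  fn_body :: "('x, 'b, 'fl, 'c, 'o) stmt"

record ('x, 'b, 'fl, 'c, 'o) program =
  prog_symbols :: "'x \<rightharpoonup> 'b"
  prog_functions :: "'b \<rightharpoonup> ('x, 'b, 'fl, 'c, 'o) func"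

text \<open>The byte offsets within the bounds are those \<open>i\<close> with \<open>low \<le> i < high\<close>.\<close>

record 'k block_contents =
  low :: int
  high :: int
  cells :: "int \<Rightarrow> 'k"

type_synonym ('b, 'k) mem = "('b, 'k block_contents) fmap"

type_synonym ('x, 'b, 'fl) env = "('x, ('b, 'fl) val) fmap"

record ('x, 'b, 'fl, 'k, 'p) state =
  st_sp :: 'b
  st_env :: "('x, 'b, 'fl) env"
  st_fp :: 'p
  st_mem :: "('b, 'k) mem"

text \<open>
  The operations the semantics leaves open. Addresses are pairs of a block and a byte offset.
  The value arguments of \<open>mem_load\<close> and \<open>mem_store\<close> are the address and, for
  \<open>mem_store\<close>, then the value stored.
\<close>

record ('x, 'b, 'fl, 'c, 'o, 'k, 'p) cminor =
  chunk_size :: "'c \<Rightarrow> nat"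
  readable :: "'p \<Rightarrow> 'b \<times> int \<Rightarrow> bool"
  writable :: "'p \<Rightarrow> 'b \<times> int \<Rightarrow> bool"
  fp_plus :: "'p \<Rightarrow> 'p \<Rightarrow> 'p option"
  fp_empty :: 'p
  mem_load :: "'c \<Rightarrow> ('b, 'k) mem \<Rightarrow> ('b, 'fl) val \<Rightarrow> ('b, 'fl) val option"
  mem_store :: "'c \<Rightarrow> ('b, 'k) mem \<Rightarrow> ('b, 'fl) val \<Rightarrow> ('b, 'fl) val \<Rightarrow> ('b, 'k) mem option"
  eval_op :: "('x, 'b, 'fl, 'c, 'o) program \<Rightarrow> 'b \<Rightarrow> 'o \<Rightarrow> ('b, 'fl) val list \<Rightarrow> ('b, 'fl) val option"
  call_entry :: "('x, 'b, 'fl, 'c, 'o) program \<Rightarrow> ('x, 'b, 'fl, 'k, 'p) state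
    \<Rightarrow> ('x, 'b, 'fl, 'c, 'o) expr \<Rightarrow> ('x, 'b, 'fl, 'c, 'o) expr list
    \<Rightarrow> (('x, 'b, 'fl, 'c, 'o) func \<times> ('x, 'b, 'fl, 'k, 'p) state) option"
  return_state :: "('x, 'b, 'fl, 'c, 'o) program \<Rightarrow> ('x, 'b, 'fl, 'k, 'p) state
    \<Rightarrow> 'x list \<Rightarrow> ('x, 'b, 'fl, 'c, 'o) func \<Rightarrow> 'b \<Rightarrow> ('x, 'b, 'fl) env \<Rightarrow> ('b, 'fl) val list
    \<Rightarrow> ('x, 'b, 'fl, 'k, 'p) state option"

text \<open>The offsets from \<open>uint i\<close> to \<open>uint i + |ch| - 1\<close> are integers; they do not wrap around.\<close>

definition fp_load :: "('x, 'b, 'fl, 'c, 'o, 'k, 'p) cminor \<Rightarrow> 'p \<Rightarrow> 'c \<Rightarrow> ('b, 'fl) val \<Rightarrow> bool" where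
  "fp_load M \<phi> ch v = (case v of
      Vptr b i \<Rightarrow> \<forall>j < chunk_size M ch. readable M \<phi> (b, uint i + int j)
    | _ \<Rightarrow> False)"

definition fp_store :: "('x, 'b, 'fl, 'c, 'o, 'k, 'p) cminor \<Rightarrow> 'p \<Rightarrow> 'c \<Rightarrow> ('b, 'fl) val \<Rightarrow> bool" where
  "fp_store M \<phi> ch v = (case v of
      Vptr b i \<Rightarrow> \<forall>j < chunk_size M ch. writable M \<phi> (b, uint i + int j)
    | _ \<Rightarrow> False)"

definition cminor_model :: "('x, 'b, 'fl, 'c, 'o, 'k, 'p) cminor \<Rightarrow> bool" where
  "cminor_model M \<longleftrightarrow>
     (\<forall>a. \<not> readable M (fp_empty M) a \<and> \<not> writable M (fp_empty M) a) \<and>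
     (\<forall>\<phi>. fp_plus M (fp_empty M) \<phi> = Some \<phi>) \<and>
     (\<forall>\<phi>\<^sub>0 \<phi>\<^sub>1. fp_plus M \<phi>\<^sub>0 \<phi>\<^sub>1 = fp_plus M \<phi>\<^sub>1 \<phi>\<^sub>0) \<and>
     (\<forall>\<phi>\<^sub>0 \<phi>\<^sub>1 \<phi>\<^sub>2. Option.bind (fp_plus M \<phi>\<^sub>0 \<phi>\<^sub>1) (\<lambda>\<phi>. fp_plus M \<phi> \<phi>\<^sub>2)
               = Option.bind (fp_plus M \<phi>\<^sub>1 \<phi>\<^sub>2) (\<lambda>\<phi>. fp_plus M \<phi>\<^sub>0 \<phi>)) \<and>
     (\<forall>\<phi>\<^sub>0 \<phi>\<^sub>1 \<phi> ch v. fp_plus M \<phi>\<^sub>0 \<phi>\<^sub>1 = Some \<phi> \<longrightarrow>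
        (fp_store M \<phi>\<^sub>0 ch v \<longrightarrow> \<not> fp_load M \<phi>\<^sub>1 ch v) \<and>
        (fp_load M \<phi>\<^sub>0 ch v \<longrightarrow> fp_load M \<phi> ch v) \<and>
        (fp_store M \<phi>\<^sub>0 ch v \<longrightarrow> fp_store M \<phi> ch v))"

inductive eval_expr :: "('x, 'b, 'fl, 'c, 'o, 'k, 'p) cminor \<Rightarrow> ('x, 'b, 'fl, 'c, 'o) program
    \<Rightarrow> ('x, 'b, 'fl, 'k, 'p) state \<Rightarrow> ('x, 'b, 'fl, 'c, 'o) expr \<Rightarrow> ('b, 'fl) val \<Rightarrow> bool"
  for M \<Psi> \<sigma> where
  eval_Eval: "eval_expr M \<Psi> \<sigma> (Eval v) v"
| eval_Evar: "fmlookup (st_env \<sigma>) x = Some v \<Longrightarrow> eval_expr M \<Psi> \<sigma> (Evar x) v"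
| eval_Eop: "list_all2 (eval_expr M \<Psi> \<sigma>) el vl \<Longrightarrow> eval_op M \<Psi> (st_sp \<sigma>) op vl = Some v
    \<Longrightarrow> eval_expr M \<Psi> \<sigma> (Eop op el) v"
| eval_Eload: "eval_expr M \<Psi> \<sigma> e v\<^sub>1 \<Longrightarrow> fp_load M (st_fp \<sigma>) ch v\<^sub>1
    \<Longrightarrow> mem_load M ch (st_mem \<sigma>) v\<^sub>1 = Some v \<Longrightarrow> eval_expr M \<Psi> \<sigma> (Eload ch e) v"
monos list_all2_mono

fun is_true :: "('b, 'fl) val \<Rightarrow> bool" where
  "is_true (Vptr b i) = True"
| "is_true (Vint i) = (i \<noteq> 0)"
| "is_true _ = False"

definition is_false :: "('b, 'fl) val \<Rightarrow> bool" where
  "is_false v \<longleftrightarrow> v = Vint 0"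

datatype ('x, 'b, 'fl, 'c, 'o) control =
    Kstop
  | Kseq "('x, 'b, 'fl, 'c, 'o) stmt" "('x, 'b, 'fl, 'c, 'o) control" (infixr \<open>\<cdot>\<close> 65)
  | Kblock "('x, 'b, 'fl, 'c, 'o) control"
  | Kcall "'x list" "('x, 'b, 'fl, 'c, 'o) func" 'b "('x, 'b, 'fl) env"
      "('x, 'b, 'fl, 'c, 'o) control"

type_synonym ('x, 'b, 'fl, 'c, 'o, 'k, 'p) continuation =
  "('x, 'b, 'fl, 'k, 'p) state \<times> ('x, 'b, 'fl, 'c, 'o) control"

fun call_control :: "('x, 'b, 'fl, 'c, 'o) control \<Rightarrow> ('x, 'b, 'fl, 'c, 'o) control" where
  "call_control (s \<cdot> \<kappa>) = call_control \<kappa>"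
| "call_control (Kblock \<kappa>) = call_control \<kappa>"
| "call_control \<kappa> = \<kappa>"

text \<open>In the rules for exit, \<open>foldr Kseq ss \<kappa>\<close> is \<open>s\<^sub>1 \<cdot> \<dots> \<cdot> s\<^sub>j \<cdot> \<kappa>\<close> for \<open>ss = [s\<^sub>1, \<dots>, s\<^sub>j]\<close>.\<close>

inductive step :: "('x, 'b, 'fl, 'c, 'o, 'k, 'p) cminor \<Rightarrow> ('x, 'b, 'fl, 'c, 'o) program
    \<Rightarrow> ('x, 'b, 'fl, 'c, 'o, 'k, 'p) continuation
    \<Rightarrow> ('x, 'b, 'fl, 'c, 'o, 'k, 'p) continuation \<Rightarrow> bool"
  for M \<Psi> where
  step_seq: "step M \<Psi> (\<sigma>, Sseq s\<^sub>1 s\<^sub>2 \<cdot> \<kappa>) (\<sigma>, s\<^sub>1 \<cdot> s\<^sub>2 \<cdot> \<kappa>)"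
| step_assign: "eval_expr M \<Psi> \<sigma> e v \<Longrightarrow>
    step M \<Psi> (\<sigma>, Sassign x e \<cdot> \<kappa>) (\<sigma>\<lparr>st_env := fmupd x v (st_env \<sigma>)\<rparr>, \<kappa>)"
| step_store: "eval_expr M \<Psi> \<sigma> e\<^sub>1 v\<^sub>1 \<Longrightarrow> eval_expr M \<Psi> \<sigma> e\<^sub>2 v\<^sub>2 \<Longrightarrow>
    fp_store M (st_fp \<sigma>) ch v\<^sub>1 \<Longrightarrow> mem_store M ch (st_mem \<sigma>) v\<^sub>1 v\<^sub>2 = Some m' \<Longrightarrow>
    step M \<Psi> (\<sigma>, Sstore ch e\<^sub>1 e\<^sub>2 \<cdot> \<kappa>) (\<sigma>\<lparr>st_mem := m'\<rparr>, \<kappa>)"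
| step_if_true: "eval_expr M \<Psi> \<sigma> e v \<Longrightarrow> is_true v \<Longrightarrow>
    step M \<Psi> (\<sigma>, Sif e s\<^sub>1 s\<^sub>2 \<cdot> \<kappa>) (\<sigma>, s\<^sub>1 \<cdot> \<kappa>)"
| step_if_false: "eval_expr M \<Psi> \<sigma> e v \<Longrightarrow> is_false v \<Longrightarrow>
    step M \<Psi> (\<sigma>, Sif e s\<^sub>1 s\<^sub>2 \<cdot> \<kappa>) (\<sigma>, s\<^sub>2 \<cdot> \<kappa>)"
| step_skip: "step M \<Psi> (\<sigma>, Sskip \<cdot> \<kappa>) (\<sigma>, \<kappa>)"
| step_loop: "step M \<Psi> (\<sigma>, Sloop s \<cdot> \<kappa>) (\<sigma>, s \<cdot> Sloop s \<cdot> \<kappa>)"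
| step_block: "step M \<Psi> (\<sigma>, Sblock s \<cdot> \<kappa>) (\<sigma>, s \<cdot> Kblock \<kappa>)"
| step_exit_0: "step M \<Psi> (\<sigma>, Sexit 0 \<cdot> foldr Kseq ss (Kblock \<kappa>)) (\<sigma>, \<kappa>)"
| step_exit_Suc: "step M \<Psi> (\<sigma>, Sexit (Suc n) \<cdot> foldr Kseq ss (Kblock \<kappa>)) (\<sigma>, Sexit n \<cdot> \<kappa>)"
| step_call: "call_entry M \<Psi> \<sigma> e el = Some (f, \<sigma>') \<Longrightarrow>
    step M \<Psi> (\<sigma>, Scall xl e el \<cdot> \<kappa>)
             (\<sigma>', fn_body f \<cdot> Kcall xl f (st_sp \<sigma>) (st_env \<sigma>) \<kappa>)"
| step_return: "call_control \<kappa> = Kcall xl f sp \<rho> \<kappa>' \<Longrightarrow>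
    list_all2 (eval_expr M \<Psi> \<sigma>) el vl \<Longrightarrow>
    return_state M \<Psi> \<sigma> xl f sp \<rho> vl = Some \<sigma>' \<Longrightarrow>
    step M \<Psi> (\<sigma>, Sreturn el \<cdot> \<kappa>) (\<sigma>', \<kappa>')"

definition stuck :: "('x, 'b, 'fl, 'c, 'o, 'k, 'p) cminor \<Rightarrow> ('x, 'b, 'fl, 'c, 'o) program
    \<Rightarrow> ('x, 'b, 'fl, 'c, 'o, 'k, 'p) continuation \<Rightarrow> bool" where
  "stuck M \<Psi> k \<longleftrightarrow> snd k \<noteq> Kstop \<and> (\<nexists>k'. step M \<Psi> k k')"

definition safe :: "('x, 'b, 'fl, 'c, 'o, 'k, 'p) cminor \<Rightarrow> ('x, 'b, 'fl, 'c, 'o) program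
    \<Rightarrow> ('x, 'b, 'fl, 'c, 'o, 'k, 'p) continuation \<Rightarrow> bool" where
  "safe M \<Psi> k \<longleftrightarrow> (\<forall>k'. (step M \<Psi>)\<^sup>*\<^sup>* k k' \<longrightarrow> \<not> stuck M \<Psi> k')"

definition mem_cell :: "('b, 'k) mem \<Rightarrow> 'b \<times> int \<Rightarrow> 'k option" where
  "mem_cell m a = (case fmlookup m (fst a) of
      None \<Rightarrow> None
    | Some c \<Rightarrow> if low c \<le> snd a \<and> snd a < high c then Some (cells c (snd a)) else None)"

text \<open>
  The portion of a memory visible through a footprint is the restriction of \<open>mem_cell\<close> to
  the addresses with some permission; it records which of them lie within the bounds of an
  allocated block, and their cells. Equality of finite maps is extensional.
\<close>

definition state_equiv :: "('x, 'b, 'fl, 'c, 'o, 'k, 'p) cminor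
    \<Rightarrow> ('x, 'b, 'fl, 'k, 'p) state \<Rightarrow> ('x, 'b, 'fl, 'k, 'p) state \<Rightarrow> bool" where
  "state_equiv M \<sigma> \<sigma>' \<longleftrightarrow>
     st_sp \<sigma> = st_sp \<sigma>' \<and> st_env \<sigma> = st_env \<sigma>' \<and> st_fp \<sigma> = st_fp \<sigma>' \<and>
     (\<forall>a. readable M (st_fp \<sigma>) a \<or> writable M (st_fp \<sigma>) a \<longrightarrow>
        mem_cell (st_mem \<sigma>) a = mem_cell (st_mem \<sigma>') a)"

type_synonym ('x, 'b, 'fl, 'c, 'o, 'k, 'p) pred =
  "('x, 'b, 'fl, 'c, 'o) program \<Rightarrow> ('x, 'b, 'fl, 'k, 'p) state \<Rightarrow> bool"

definition is_assertion :: "('x, 'b, 'fl, 'c, 'o, 'k, 'p) cminor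
    \<Rightarrow> ('x, 'b, 'fl, 'c, 'o, 'k, 'p) pred \<Rightarrow> bool" where
  "is_assertion M P \<longleftrightarrow> (\<forall>\<Psi> \<sigma> \<sigma>'. state_equiv M \<sigma> \<sigma>' \<longrightarrow> P \<Psi> \<sigma> = P \<Psi> \<sigma>')"

definition is_closed_assertion :: "('x, 'b, 'fl, 'c, 'o, 'k, 'p) cminor
    \<Rightarrow> ('x, 'b, 'fl, 'c, 'o, 'k, 'p) pred \<Rightarrow> bool" where
  "is_closed_assertion M P \<longleftrightarrow>
     is_assertion M P \<and> (\<forall>\<Psi> \<sigma> \<rho>'. P \<Psi> (\<sigma>\<lparr>st_env := \<rho>'\<rparr>) = P \<Psi> \<sigma>)"

definition false_assertion :: "('x, 'b, 'fl, 'c, 'o, 'k, 'p) pred" where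
  "false_assertion = (\<lambda>\<Psi> \<sigma>. False)"

definition entails :: "('x, 'b, 'fl, 'c, 'o, 'k, 'p) pred
    \<Rightarrow> ('x, 'b, 'fl, 'c, 'o, 'k, 'p) pred \<Rightarrow> bool" where
  "entails P Q \<longleftrightarrow> (\<forall>\<Psi> \<sigma>. P \<Psi> \<sigma> \<longrightarrow> Q \<Psi> \<sigma>)"

definition sep_conj :: "('x, 'b, 'fl, 'c, 'o, 'k, 'p) cminor
    \<Rightarrow> ('x, 'b, 'fl, 'c, 'o, 'k, 'p) pred \<Rightarrow> ('x, 'b, 'fl, 'c, 'o, 'k, 'p) pred
    \<Rightarrow> ('x, 'b, 'fl, 'c, 'o, 'k, 'p) pred" where
  "sep_conj M P Q = (\<lambda>\<Psi> \<sigma>. \<exists>\<phi>\<^sub>1 \<phi>\<^sub>2. fp_plus M \<phi>\<^sub>1 \<phi>\<^sub>2 = Some (st_fp \<sigma>) \<and>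
     P \<Psi> (\<sigma>\<lparr>st_fp := \<phi>\<^sub>1\<rparr>) \<and> Q \<Psi> (\<sigma>\<lparr>st_fp := \<phi>\<^sub>2\<rparr>))"

definition safe_assertion :: "('x, 'b, 'fl, 'c, 'o, 'k, 'p) cminor
    \<Rightarrow> ('x, 'b, 'fl, 'c, 'o) control \<Rightarrow> ('x, 'b, 'fl, 'c, 'o, 'k, 'p) pred" where
  "safe_assertion M \<kappa> = (\<lambda>\<Psi> \<sigma>. \<forall>\<sigma>'. state_equiv M \<sigma> \<sigma>' \<longrightarrow> safe M \<Psi> (\<sigma>', \<kappa>))"

definition guard :: "('x, 'b, 'fl, 'c, 'o, 'k, 'p) cminor
    \<Rightarrow> ('x, 'b, 'fl, 'c, 'o, 'k, 'p) pred \<Rightarrow> ('x, 'b, 'fl, 'c, 'o, 'k, 'p) pred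
    \<Rightarrow> ('x, 'b, 'fl, 'c, 'o) control \<Rightarrow> bool" where
  "guard M F P \<kappa> \<longleftrightarrow> entails (sep_conj M F P) (safe_assertion M \<kappa>)"

definition rguard :: "('x, 'b, 'fl, 'c, 'o, 'k, 'p) cminor
    \<Rightarrow> ('x, 'b, 'fl, 'c, 'o, 'k, 'p) pred
    \<Rightarrow> (('b, 'fl) val list \<Rightarrow> ('x, 'b, 'fl, 'c, 'o, 'k, 'p) pred)
    \<Rightarrow> ('x, 'b, 'fl, 'c, 'o) control \<Rightarrow> bool" where
  "rguard M F R \<kappa> \<longleftrightarrow> (\<forall>vl. guard M F (R vl) (Sreturn (map Eval vl) \<cdot> \<kappa>))"

definition bguard :: "('x, 'b, 'fl, 'c, 'o, 'k, 'p) cminor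
    \<Rightarrow> ('x, 'b, 'fl, 'c, 'o, 'k, 'p) pred
    \<Rightarrow> (nat \<Rightarrow> ('x, 'b, 'fl, 'c, 'o, 'k, 'p) pred)
    \<Rightarrow> ('x, 'b, 'fl, 'c, 'o) control \<Rightarrow> bool" where
  "bguard M F B \<kappa> \<longleftrightarrow> (\<forall>n. guard M F (B n) (Sexit n \<cdot> \<kappa>))"

fun modified_vars :: "('x, 'b, 'fl, 'c, 'o) stmt \<Rightarrow> 'x set" where
  "modified_vars (Sassign x e) = {x}"
| "modified_vars (Sstore ch e\<^sub>1 e\<^sub>2) = {}"
| "modified_vars (Sloop s) = modified_vars s"
| "modified_vars (Sblock s) = modified_vars s"
| "modified_vars (Sexit n) = {}"
| "modified_vars (Scall xl e el) = set xl"
| "modified_vars (Sreturn el) = {}"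
| "modified_vars (Sseq s\<^sub>1 s\<^sub>2) = modified_vars s\<^sub>1 \<union> modified_vars s\<^sub>2"
| "modified_vars (Sif e s\<^sub>1 s\<^sub>2) = modified_vars s\<^sub>1 \<union> modified_vars s\<^sub>2"
| "modified_vars Sskip = {}"

definition closemod :: "('x, 'b, 'fl, 'c, 'o) stmt
    \<Rightarrow> ('x, 'b, 'fl, 'c, 'o, 'k, 'p) pred \<Rightarrow> ('x, 'b, 'fl, 'c, 'o, 'k, 'p) pred" where
  "closemod s A = (\<lambda>\<Psi> \<sigma>. \<forall>\<rho>'.
     (\<forall>x. x \<notin> modified_vars s \<longrightarrow> fmlookup \<rho>' x = fmlookup (st_env \<sigma>) x) \<longrightarrow>
     A \<Psi> (\<sigma>\<lparr>st_env := \<rho>'\<rparr>))"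

definition frame :: "('x, 'b, 'fl, 'c, 'o, 'k, 'p) cminor
    \<Rightarrow> ('x, 'b, 'fl, 'c, 'o, 'k, 'p) pred \<Rightarrow> ('x, 'b, 'fl, 'c, 'o, 'k, 'p) pred
    \<Rightarrow> ('x, 'b, 'fl, 'c, 'o) stmt \<Rightarrow> ('x, 'b, 'fl, 'c, 'o, 'k, 'p) pred" where
  "frame M \<Gamma> A s = sep_conj M \<Gamma> (closemod s A)"

definition sextuple :: "('x, 'b, 'fl, 'c, 'o, 'k, 'p) cminor
    \<Rightarrow> ('x, 'b, 'fl, 'c, 'o, 'k, 'p) pred
    \<Rightarrow> (('b, 'fl) val list \<Rightarrow> ('x, 'b, 'fl, 'c, 'o, 'k, 'p) pred)
    \<Rightarrow> (nat \<Rightarrow> ('x, 'b, 'fl, 'c, 'o, 'k, 'p) pred)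
    \<Rightarrow> ('x, 'b, 'fl, 'c, 'o, 'k, 'p) pred \<Rightarrow> ('x, 'b, 'fl, 'c, 'o) stmt
    \<Rightarrow> ('x, 'b, 'fl, 'c, 'o, 'k, 'p) pred \<Rightarrow> bool" where
  "sextuple M \<Gamma> R B P s Q \<longleftrightarrow>
     (\<forall>A \<kappa>. is_assertion M A \<longrightarrow>
        rguard M (frame M \<Gamma> A s) R \<kappa> \<longrightarrow>
        bguard M (frame M \<Gamma> A s) B \<kappa> \<longrightarrow>
        guard M (frame M \<Gamma> A s) Q \<kappa> \<longrightarrow>
        guard M (frame M \<Gamma> A s) P (s \<cdot> \<kappa>))"

end

theory Submission imports Defs begin

text \<open>
  Fix a number \<open>n\<close> and replace the loop by \<open>n\<close> copies of its body followed by \<open>loop skip\<close>. The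
  latter diverges, hence is safe in every state, so the triple for the body, used \<open>n\<close> times,
  shows that the replacement is safe. A run of the loop of fewer than \<open>n\<close> steps is simulated by
  the replacement, as each unfolding of the loop consumes a step. So a stuck continuation
  reachable from the loop would give one reachable from the replacement for large \<open>n\<close>.
\<close>

text \<open>Functional form of the pattern \<open>foldr Kseq ss (Kblock \<kappa>)\<close> in the
  rules for exit, in the style of \<open>call_control\<close>. It is \<open>None\<close> if
  \<open>Kstop\<close> or a \<open>Kcall\<close> comes before any \<open>Kblock\<close>.\<close>

fun exit_target :: "('x, 'b, 'fl, 'c, 'o) control \<Rightarrow> ('x, 'b, 'fl, 'c, 'o) control option" where
  "exit_target (s \<cdot> \<kappa>) = exit_target \<kappa>"
| "exit_target (Kblock \<kappa>) = Some \<kappa>"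
| "exit_target \<kappa> = None"

lemma exit_target_foldr [simp]: "exit_target (foldr Kseq ss \<kappa>) = exit_target \<kappa>"
  by (induction ss) auto

lemma exit_target_SomeD: "exit_target \<kappa> = Some \<kappa>' \<Longrightarrow> \<exists>ss. \<kappa> = foldr Kseq ss (Kblock \<kappa>')"
proof (induction \<kappa> rule: exit_target.induct)
  case (1 s \<kappa>)
  then obtain ss where "\<kappa> = foldr Kseq ss (Kblock \<kappa>')" by auto
  then have "s \<cdot> \<kappa> = foldr Kseq (s # ss) (Kblock \<kappa>')" by simp
  then show ?case by blast
next
  case (2 \<kappa>)
  then have "Kblock \<kappa> = foldr Kseq [] (Kblock \<kappa>')" by simp
  then show ?case by blast
qed auto

text \<open>In this form the successors depend on the control below the exit only through
  \<open>exit_target\<close>, which ignores leading statements.\<close>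

lemma step_exit_iff:
  "step M \<Psi> (\<sigma>, Sexit n \<cdot> \<kappa>) k \<longleftrightarrow>
   (\<exists>\<kappa>'. exit_target \<kappa> = Some \<kappa>' \<and> k = (\<sigma>, case n of 0 \<Rightarrow> \<kappa>' | Suc i \<Rightarrow> Sexit i \<cdot> \<kappa>'))"
  (is "?L \<longleftrightarrow> ?R")
proof
  assume ?L then show ?R by cases auto
next
  assume ?R
  then obtain \<kappa>' where "exit_target \<kappa> = Some \<kappa>'"
    and k: "k = (\<sigma>, case n of 0 \<Rightarrow> \<kappa>' | Suc i \<Rightarrow> Sexit i \<cdot> \<kappa>')" by blast
  then obtain ss where "\<kappa> = foldr Kseq ss (Kblock \<kappa>')" using exit_target_SomeD by blast
  then show ?L using k by (cases n) (auto intro: step.intros)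
qed

lemma step_return_iff:
  "step M \<Psi> (\<sigma>, Sreturn el \<cdot> \<kappa>) k \<longleftrightarrow>
   (\<exists>xl f sp \<rho> \<kappa>' vl \<sigma>'. call_control \<kappa> = Kcall xl f sp \<rho> \<kappa>' \<and>
      list_all2 (eval_expr M \<Psi> \<sigma>) el vl \<and> return_state M \<Psi> \<sigma> xl f sp \<rho> vl = Some \<sigma>' \<and>
      k = (\<sigma>', \<kappa>'))"
  (is "?L \<longleftrightarrow> ?R")
proof
  assume ?L then show ?R by cases auto
next
  assume ?R then show ?L by (auto intro: step.intros)
qed

lemma safe_unfold: "safe M \<Psi> k \<longleftrightarrow> \<not> stuck M \<Psi> k \<and> (\<forall>k'. step M \<Psi> k k' \<longrightarrow> safe M \<Psi> k')"
  unfolding safe_def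
proof (intro iffI conjI allI impI; (elim conjE)?)
  fix k' assume "\<not> stuck M \<Psi> k" and r: "(step M \<Psi>)\<^sup>*\<^sup>* k k'"
    and "\<forall>k'. step M \<Psi> k k' \<longrightarrow> (\<forall>k''. (step M \<Psi>)\<^sup>*\<^sup>* k' k'' \<longrightarrow> \<not> stuck M \<Psi> k'')"
  then show "\<not> stuck M \<Psi> k'" using r by (blast elim: converse_rtranclpE)
qed (blast intro: converse_rtranclp_into_rtranclp)+

text \<open>Neither control is \<open>Kstop\<close>, so stuckness is decided by the successors
  alone, and these agree.\<close>

lemma safe_cong_step:
  assumes "\<And>k'. step M \<Psi> (\<sigma>, s \<cdot> \<kappa>) k' \<longleftrightarrow> step M \<Psi> (\<sigma>, s' \<cdot> \<kappa>') k'"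
  shows "safe M \<Psi> (\<sigma>, s \<cdot> \<kappa>) \<longleftrightarrow> safe M \<Psi> (\<sigma>, s' \<cdot> \<kappa>')"
  unfolding safe_unfold[of _ _ "(\<sigma>, s \<cdot> \<kappa>)"] safe_unfold[of _ _ "(\<sigma>, s' \<cdot> \<kappa>')"]
  by (simp add: assms stuck_def)

lemma safe_return_Kseq: "safe M \<Psi> (\<sigma>, Sreturn el \<cdot> t \<cdot> \<kappa>) \<longleftrightarrow> safe M \<Psi> (\<sigma>, Sreturn el \<cdot> \<kappa>)"
  by (rule safe_cong_step) (simp add: step_return_iff)

lemma safe_exit_Kseq: "safe M \<Psi> (\<sigma>, Sexit n \<cdot> t \<cdot> \<kappa>) \<longleftrightarrow> safe M \<Psi> (\<sigma>, Sexit n \<cdot> \<kappa>)"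
  by (rule safe_cong_step) (simp add: step_exit_iff)

text \<open>A return discards the statements in front of the enclosing call, so guards survive
  pushing copies of the loop body. \<open>bguard_Kseq\<close> does the same for exits.\<close>

lemma rguard_Kseq: "rguard M F R (t \<cdot> \<kappa>) \<longleftrightarrow> rguard M F R \<kappa>"
  by (simp add: rguard_def guard_def safe_assertion_def safe_return_Kseq)

lemma bguard_Kseq: "bguard M F B (t \<cdot> \<kappa>) \<longleftrightarrow> bguard M F B \<kappa>"
  by (simp add: bguard_def guard_def safe_assertion_def safe_exit_Kseq)

inductive_cases step_skipE: "step M \<Psi> (\<sigma>, Sskip \<cdot> \<kappa>) k"
inductive_cases step_loopE: "step M \<Psi> (\<sigma>, Sloop s \<cdot> \<kappa>) k"

text \<open>Runs alternate between two continuations, each of which has a successor.\<close>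

lemma safe_loop_skip: "safe M \<Psi> (\<sigma>, Sloop Sskip \<cdot> \<kappa>)"
  unfolding safe_def
proof (intro allI impI)
  fix k assume "(step M \<Psi>)\<^sup>*\<^sup>* (\<sigma>, Sloop Sskip \<cdot> \<kappa>) k"
  then have "k = (\<sigma>, Sloop Sskip \<cdot> \<kappa>) \<or> k = (\<sigma>, Sskip \<cdot> Sloop Sskip \<cdot> \<kappa>)"
    by induction (auto elim: step_skipE step_loopE)
  then show "\<not> stuck M \<Psi> k"
    by (auto simp: stuck_def intro: step_skip step_loop)
qed

text \<open>\<open>m\<close> is the number of steps for which the right-hand control is sure to follow the left-hand one.\<close>

inductive unrolled :: "nat \<Rightarrow> ('x, 'b, 'fl, 'c, 'o) control \<Rightarrow> ('x, 'b, 'fl, 'c, 'o) control \<Rightarrow> bool" where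
  unrolled_refl: "unrolled m \<kappa> \<kappa>"
| unrolled_loop: "m \<le> n \<Longrightarrow> unrolled m (Sloop s \<cdot> \<kappa>) ((Kseq s ^^ n) (Sloop Sskip \<cdot> \<kappa>))"
| unrolled_Kseq: "unrolled m \<kappa> \<kappa>' \<Longrightarrow> unrolled m (s \<cdot> \<kappa>) (s \<cdot> \<kappa>')"
| unrolled_Kblock: "unrolled m \<kappa> \<kappa>' \<Longrightarrow> unrolled m (Kblock \<kappa>) (Kblock \<kappa>')"
| unrolled_Kcall: "unrolled m \<kappa> \<kappa>' \<Longrightarrow> unrolled m (Kcall xl f sp \<rho> \<kappa>) (Kcall xl f sp \<rho> \<kappa>')"

lemma unrolled_mono: "unrolled m \<kappa> \<kappa>' \<Longrightarrow> m' \<le> m \<Longrightarrow> unrolled m' \<kappa> \<kappa>'"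
  by (induction rule: unrolled.induct) (auto intro: unrolled.intros)

lemma exit_target_Kseq_funpow [simp]: "exit_target ((Kseq s ^^ n) \<kappa>) = exit_target \<kappa>"
  by (induction n) auto

lemma call_control_Kseq_funpow [simp]: "call_control ((Kseq s ^^ n) \<kappa>) = call_control \<kappa>"
  by (induction n) auto

text \<open>In the case \<open>unrolled_loop\<close> both controls merely put statements in front of
  the same control, so their targets coincide.\<close>

lemma unrolled_exit_target:
  "unrolled m \<kappa> \<kappa>' \<Longrightarrow> rel_option (unrolled m) (exit_target \<kappa>) (exit_target \<kappa>')"
  by (induction rule: unrolled.induct) (auto intro: unrolled.intros option.rel_refl)

lemma unrolled_call_control: "unrolled m \<kappa> \<kappa>' \<Longrightarrow> unrolled m (call_control \<kappa>) (call_control \<kappa>')"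
  by (induction rule: unrolled.induct) (auto intro: unrolled.intros)

lemma call_control_neq_Kseq [simp]: "call_control \<kappa> \<noteq> s \<cdot> \<kappa>'"
  by (induction \<kappa> rule: call_control.induct) auto

lemma Kseq_funpow_neq [simp]:
  "(Kseq s ^^ n) (t \<cdot> \<kappa>) \<noteq> Kcall xl f sp \<rho> \<kappa>'" "(Kseq s ^^ n) (t \<cdot> \<kappa>) \<noteq> Kblock \<kappa>'"
  "(Kseq s ^^ n) (t \<cdot> \<kappa>) \<noteq> Kstop"
  by (cases n; simp)+

lemma unrolled_KcallE:
  assumes "unrolled m (Kcall xl f sp \<rho> \<kappa>) \<kappa>'"
  obtains \<kappa>'' where "\<kappa>' = Kcall xl f sp \<rho> \<kappa>''" "unrolled m \<kappa> \<kappa>''"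
  using assms by cases (auto intro: unrolled_refl)

lemma unrolled_Kcall_call_controlE:
  assumes "unrolled m (call_control \<kappa>) (Kcall xl f sp \<rho> \<kappa>')"
  obtains \<kappa>'' where "call_control \<kappa> = Kcall xl f sp \<rho> \<kappa>''"
  using assms by cases (auto intro: that that[OF sym])

text \<open>Both sides have the same head statement, and only exit and return inspect the control
  below it. Even a loop at the head unfolds alike on both sides, so \<open>m\<close> does not
  drop.\<close>

lemma step_Kseq_simulation:
  assumes "step M \<Psi> (\<sigma>, s \<cdot> \<kappa>) (\<sigma>\<^sub>1, \<kappa>\<^sub>1)" and u: "unrolled m \<kappa> \<kappa>'"
  shows "\<exists>\<kappa>\<^sub>1'. step M \<Psi> (\<sigma>, s \<cdot> \<kappa>') (\<sigma>\<^sub>1, \<kappa>\<^sub>1') \<and> unrolled m \<kappa>\<^sub>1 \<kappa>\<^sub>1'"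
proof (cases s)
  case (Sexit n)
  then obtain \<kappa>\<^sub>0 where \<kappa>\<^sub>0: "exit_target \<kappa> = Some \<kappa>\<^sub>0"
    "\<sigma>\<^sub>1 = \<sigma>" "\<kappa>\<^sub>1 = (case n of 0 \<Rightarrow> \<kappa>\<^sub>0 | Suc i \<Rightarrow> Sexit i \<cdot> \<kappa>\<^sub>0)"
    using assms(1) by (auto simp: step_exit_iff)
  obtain \<kappa>\<^sub>0' where "exit_target \<kappa>' = Some \<kappa>\<^sub>0'" "unrolled m \<kappa>\<^sub>0 \<kappa>\<^sub>0'"
    using unrolled_exit_target[OF u] \<kappa>\<^sub>0(1) by (auto simp: option_rel_Some1)
  then show ?thesis
    using Sexit \<kappa>\<^sub>0 by (cases n) (auto simp: step_exit_iff intro: unrolled_Kseq)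
next
  case (Sreturn el)
  then obtain xl f sp \<rho> vl where r: "call_control \<kappa> = Kcall xl f sp \<rho> \<kappa>\<^sub>1"
    "list_all2 (eval_expr M \<Psi> \<sigma>) el vl" "return_state M \<Psi> \<sigma> xl f sp \<rho> vl = Some \<sigma>\<^sub>1"
    using assms(1) by (auto simp: step_return_iff)
  obtain \<kappa>\<^sub>1' where "call_control \<kappa>' = Kcall xl f sp \<rho> \<kappa>\<^sub>1'" "unrolled m \<kappa>\<^sub>1 \<kappa>\<^sub>1'"
    using unrolled_call_control[OF u] r(1) by (auto elim: unrolled_KcallE)
  then show ?thesis using Sreturn r by (auto intro: step_return)
qed (insert assms, (simp, erule step.cases; simp; blast intro: step.intros unrolled_Kseq unrolled_Kblock unrolled_Kcall)+)

text \<open>The converse direction, needed to carry stuckness from left to right; where the step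
  leads is irrelevant for that.\<close>

lemma step_Kseq_progress:
  assumes "step M \<Psi> (\<sigma>, s \<cdot> \<kappa>') k" and u: "unrolled m \<kappa> \<kappa>'"
  shows "\<exists>k'. step M \<Psi> (\<sigma>, s \<cdot> \<kappa>) k'"
proof (cases s)
  case (Sexit n)
  then show ?thesis
    using assms(1) unrolled_exit_target[OF u] by (auto simp: step_exit_iff option_rel_Some2)
next
  case (Sreturn el)
  then show ?thesis
    using assms(1) unrolled_call_control[OF u]
    by (fastforce simp: step_return_iff elim: unrolled_Kcall_call_controlE)
qed (insert assms(1), (simp, erule step.cases; simp; blast intro: step.intros)+)

lemma step_Kseq_only:
  assumes "step M \<Psi> (\<sigma>, \<kappa>) k" obtains s \<kappa>' where "\<kappa> = s \<cdot> \<kappa>'"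
  using assms by cases auto

lemma unrolled_step:
  assumes st: "step M \<Psi> (\<sigma>, \<kappa>) (\<sigma>\<^sub>1, \<kappa>\<^sub>1)" and u: "unrolled (Suc m) \<kappa> \<kappa>'"
  shows "\<exists>\<kappa>\<^sub>1'. (step M \<Psi>)\<^sup>*\<^sup>* (\<sigma>, \<kappa>') (\<sigma>\<^sub>1, \<kappa>\<^sub>1') \<and> unrolled m \<kappa>\<^sub>1 \<kappa>\<^sub>1'"
  using u
proof cases
  case unrolled_refl
  then show ?thesis using st by (blast intro: unrolled.unrolled_refl)
next
  case (unrolled_loop n s \<kappa>\<^sub>0)
  \<comment> \<open>Here \<open>n\<close> is at least \<open>Suc m\<close>, so a copy of the body
    already stands in front on the right. The right side makes no step, and one unit of the index
    pays for the copy.\<close>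
  then obtain i where i: "n = Suc i" "m \<le> i" by (cases n) auto
  have "\<sigma>\<^sub>1 = \<sigma>" "\<kappa>\<^sub>1 = s \<cdot> Sloop s \<cdot> \<kappa>\<^sub>0"
    using st unrolled_loop(1) by (auto elim: step_loopE)
  moreover have "unrolled m (s \<cdot> Sloop s \<cdot> \<kappa>\<^sub>0) \<kappa>'"
    unfolding unrolled_loop(2) i(1) funpow.simps(2) comp_apply
    by (intro unrolled.unrolled_Kseq unrolled.unrolled_loop i(2))
  ultimately show ?thesis by blast
next
  case (unrolled_Kseq \<kappa>\<^sub>0 \<kappa>\<^sub>0' s)
  then obtain \<kappa>\<^sub>1' where "step M \<Psi> (\<sigma>, \<kappa>') (\<sigma>\<^sub>1, \<kappa>\<^sub>1')" "unrolled (Suc m) \<kappa>\<^sub>1 \<kappa>\<^sub>1'"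
    using st step_Kseq_simulation by blast
  then show ?thesis by (blast intro: unrolled_mono[OF _ le_SucI[OF order_refl]])
qed (use st in \<open>auto elim: step_Kseq_only\<close>)

text \<open>This holds even for \<open>m = 0\<close>, when no copy of the body need be left: a loop
  can always step, so \<open>unrolled_loop\<close> never relates a stuck control to anything.
  Controls headed by \<open>Kblock\<close> or \<open>Kcall\<close> are stuck on both sides.\<close>

lemma unrolled_stuck:
  assumes "stuck M \<Psi> (\<sigma>, \<kappa>)" and u: "unrolled m \<kappa> \<kappa>'"
  shows "stuck M \<Psi> (\<sigma>, \<kappa>')"
  using u
proof cases
  case (unrolled_Kseq \<kappa>\<^sub>0 \<kappa>\<^sub>0' s)
  then show ?thesis
    using assms(1) step_Kseq_progress[OF _ unrolled_Kseq(3)]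
    unfolding stuck_def unrolled_Kseq(1,2) snd_conv by blast
qed (use assms(1) in \<open>auto simp: stuck_def intro: step_loop elim: step_Kseq_only\<close>)

text \<open>Each step of the run lowers the index by one, so an initial index equal to the length of
  the run lasts until the stuck continuation.\<close>

lemma unrolled_reaches_stuck:
  assumes "(step M \<Psi> ^^ n) (\<sigma>, \<kappa>) k" "stuck M \<Psi> k" "unrolled n \<kappa> \<kappa>'"
  shows "\<not> safe M \<Psi> (\<sigma>, \<kappa>')"
  using assms
proof (induction n arbitrary: \<sigma> \<kappa> \<kappa>')
  case 0
  then have "stuck M \<Psi> (\<sigma>, \<kappa>')" by (auto intro: unrolled_stuck)
  then show ?case using safe_unfold by blast
next
  case (Suc n)
  then obtain \<sigma>\<^sub>1 \<kappa>\<^sub>1 where st: "step M \<Psi> (\<sigma>, \<kappa>) (\<sigma>\<^sub>1, \<kappa>\<^sub>1)" "(step M \<Psi> ^^ n) (\<sigma>\<^sub>1, \<kappa>\<^sub>1) k"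
    using relpowp_Suc_D2[OF Suc.prems(1)] by auto
  obtain \<kappa>\<^sub>1' where "(step M \<Psi>)\<^sup>*\<^sup>* (\<sigma>, \<kappa>') (\<sigma>\<^sub>1, \<kappa>\<^sub>1')" "unrolled n \<kappa>\<^sub>1 \<kappa>\<^sub>1'"
    using unrolled_step[OF st(1) Suc.prems(3)] by blast
  moreover from this have "\<not> safe M \<Psi> (\<sigma>\<^sub>1, \<kappa>\<^sub>1')" using Suc.IH st(2) Suc.prems(2) by blast
  ultimately show ?case unfolding safe_def by (blast intro: rtranclp_trans)
qed

lemma safe_loopI:
  assumes "\<And>n. safe M \<Psi> (\<sigma>, (Kseq s ^^ n) (Sloop Sskip \<cdot> \<kappa>))"
  shows "safe M \<Psi> (\<sigma>, Sloop s \<cdot> \<kappa>)"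
  unfolding safe_def
proof (intro allI impI notI)
  fix k assume "(step M \<Psi>)\<^sup>*\<^sup>* (\<sigma>, Sloop s \<cdot> \<kappa>) k" and k: "stuck M \<Psi> k"
  then obtain n where "(step M \<Psi> ^^ n) (\<sigma>, Sloop s \<cdot> \<kappa>) k" by (meson rtranclp_imp_relpowp)
  then have "\<not> safe M \<Psi> (\<sigma>, (Kseq s ^^ n) (Sloop Sskip \<cdot> \<kappa>))"
    using k unrolled_loop[OF order_refl] by (rule unrolled_reaches_stuck)
  then show False using assms by contradiction
qed

text \<open>A loop modifies the same variables as its body, so the sextuple for the body applies
  under the frame of the loop.\<close>

lemma frame_loop: "frame M \<Gamma> A (Sloop s) = frame M \<Gamma> A s"
  by (simp add: frame_def closemod_def)

theorem theorem1:
  fixes M :: "('x, 'b, 'fl, 'c, 'o, 'k, 'p) cminor"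
    and \<Gamma> I :: "('x, 'b, 'fl, 'c, 'o, 'k, 'p) pred"
    and R :: "('b, 'fl) val list \<Rightarrow> ('x, 'b, 'fl, 'c, 'o, 'k, 'p) pred"
    and B :: "nat \<Rightarrow> ('x, 'b, 'fl, 'c, 'o, 'k, 'p) pred"
    and s :: "('x, 'b, 'fl, 'c, 'o) stmt"
  assumes "cminor_model M"
    and "is_closed_assertion M \<Gamma>"
    and "\<And>vl. is_assertion M (R vl)"
    and "\<And>n. is_assertion M (B n)"
    and "is_assertion M I"
    and "sextuple M \<Gamma> R B I s I"
  shows "sextuple M \<Gamma> R B I (Sloop s) false_assertion"
proof -
  have "guard M (frame M \<Gamma> A s) I (Sloop s \<cdot> \<kappa>)"
    if A: "is_assertion M A" and r: "rguard M (frame M \<Gamma> A s) R \<kappa>"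
      and b: "bguard M (frame M \<Gamma> A s) B \<kappa>" for A \<kappa>
  proof -
    let ?F = "frame M \<Gamma> A s" and ?\<kappa> = "\<lambda>n. (Kseq s ^^ n) (Sloop Sskip \<cdot> \<kappa>)"
    \<comment> \<open>The guards for \<open>R\<close> and \<open>B\<close> are carried along because
      the induction step uses the sextuple for \<open>s\<close> with \<open>?\<kappa> n\<close> as
      its control; the guard for \<open>I\<close> then serves as its postcondition guard.\<close>
    have "rguard M ?F R (?\<kappa> n) \<and> bguard M ?F B (?\<kappa> n) \<and> guard M ?F I (?\<kappa> n)" for n
    proof (induction n)
      case 0
      \<comment> \<open>The control is safe in every state, so any precondition guards it.\<close>
      have "guard M ?F I (Sloop Sskip \<cdot> \<kappa>)"
        unfolding guard_def entails_def safe_assertion_def by (blast intro: safe_loop_skip)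
      then show ?case using r b by (simp add: rguard_Kseq bguard_Kseq)
    next
      case (Suc n)
      then have "guard M ?F I (s \<cdot> ?\<kappa> n)" using assms(6) A unfolding sextuple_def by blast
      then show ?case using Suc by (simp add: rguard_Kseq bguard_Kseq)
    qed
    then have "guard M ?F I (?\<kappa> n)" for n by blast
    then show ?thesis
      unfolding guard_def entails_def safe_assertion_def by (blast intro: safe_loopI)
  qed
  then show ?thesis unfolding sextuple_def frame_loop by blast
qed

end
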